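(* Let $p\in\mathbb{N}$ and let $(X_t)_{t\in\mathbb{N}}$ be an order-$p$ parametric autoregressive time series with parameter space $\mathbb{T}$, as described in the context. Let $(\hat\Theta_T)_{T\ge p}$ be a non-anticipatory sequence of $\mathbb{T}$-valued estimators, i.e. for each $T$, $\hat\Theta_T$ is a (measurable) function of $(X_1,\dots,X_T)$ only. For $\theta\in\mathbb{T}$ define $M_T(\theta)=1$ for $0\le T\le p$ and $$M_T(\theta)=\frac{\prod_{t=p+1}^{T} f\left(X_t\mid X_{t-p},\dots,X_{t-1};\hat\Theta_{t-1}\right)}{\prod_{t=p+1}^{T} f\left(X_t\mid X_{t-p},\dots,X_{t-1};\theta\right)}\qquad\text{for } T\ge p+1.$$ For $\alpha\in(0,1)$ and $T\in\mathbb{N}$ define the random set $$\mathscr{D}_T^{\alpha}=\left\{\theta\in\mathbb{T}: M_T(\theta)\le 1/\alpha\right\}.$$ Then for every $\alpha\in(0,1)$ and every $\theta_0\in\mathbb{T}$, $$\mathrm{Pr}_{\theta_0}\left(\theta_0\in\mathscr{D}_T^{\alpha}\ \text{for all } T\in\mathbb{N}\right)\ge 1-\alpha.$$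
   Context: Setting. $\mathbb{X}$ is a measurable space with a $\sigma$-finite reference measure, written $\mathrm{d}x$; $\mathbb{T}$ is a measurable parameter space. For each $\theta\in\mathbb{T}$ there are given a probability density function (PDF) $f(x_1,\dots,x_p;\theta)$ on $\mathbb{X}^p$ (with respect to the product reference measure) and a conditional PDF $f(x\mid z;\theta)\ge 0$, $x\in\mathbb{X}$, $z\in\mathbb{X}^p$, with $\int_{\mathbb{X}} f(x\mid z;\theta)\,\mathrm{d}x=1$ for every $z\in\mathbb{X}^p$. The densities are jointly measurable in all arguments, including $\theta$. $\mathrm{Pr}_\theta$ denotes the probability measure under which $(X_1,\dots,X_p)$ has PDF $f(\cdot;\theta)$ and, for each $t>p$, the conditional law of $X_t$ given $\mathcal{F}_{t-1}=\sigma(X_1,\dots,X_{t-1})$ has PDF $f(\cdot\mid X_{t-p},\dots,X_{t-1};\theta)$. Equivalently, for every $T>p$, $(X_1,\dots,X_T)$ has joint PDF $$f(x_1,\dots,x_p;\theta)\prod_{t=p+1}^{T} f(x_t\mid x_{t-p},\dots,x_{t-1};\theta).$$ Convention: a likelihood ratio with zero denominator is assigned the value $+\infty$ (for $M_T(\theta)$ this happens with $\mathrm{Pr}_\theta$-probability zero). *)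

theory Defs
  imports "HOL-Probability.Probability"
begin

text \<open>Time starts at 1: the value of a path at 0 is never used. Elements of the n-fold product
  space are extensional functions on \<open>{1..n}\<close>, i.e. points of \<open>PiM {1..n} (\<lambda>_. M)\<close>.\<close>

definition history :: "nat \<Rightarrow> (nat \<Rightarrow> 'x) \<Rightarrow> nat \<Rightarrow> 'x" where
  "history n x = restrict x {1..n}"

text \<open>For \<open>t > p\<close>, the vector of lags (x (t - p), ..., x (t - 1)), re-indexed by \<open>{1..p}\<close>;
  the truncated subtraction is harmless in this range.\<close>

definition lags :: "nat \<Rightarrow> (nat \<Rightarrow> 'x) \<Rightarrow> nat \<Rightarrow> nat \<Rightarrow> 'x" where
  "lags p x t = (\<lambda>i\<in>{1..p}. x (t - p - 1 + i))"

text \<open>\<open>f0 x \<theta>\<close> is the initial density and \<open>f x z \<theta>\<close> the conditional density of x given the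
  p-vector z, both relative to the \<open>\<sigma>\<close>-finite reference measure \<open>M\<close>. Of \<open>N\<close>, only the
  measurable space is used.\<close>

locale ar_densities = sigma_finite_measure M
  for M :: "'x measure" and N :: "'t measure" and p :: nat
    and f0 :: "(nat \<Rightarrow> 'x) \<Rightarrow> 't \<Rightarrow> real"
    and f :: "'x \<Rightarrow> (nat \<Rightarrow> 'x) \<Rightarrow> 't \<Rightarrow> real" +
  assumes f0_measurable:
      "(\<lambda>(x, \<theta>). f0 x \<theta>) \<in> borel_measurable (PiM {1..p} (\<lambda>_. M) \<Otimes>\<^sub>M N)"
    and f0_nonneg:
      "\<And>x \<theta>. x \<in> space (PiM {1..p} (\<lambda>_. M)) \<Longrightarrow> \<theta> \<in> space N \<Longrightarrow> f0 x \<theta> \<ge> 0"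
    and f0_integral:
      "\<And>\<theta>. \<theta> \<in> space N \<Longrightarrow> (\<integral>\<^sup>+ x. ennreal (f0 x \<theta>) \<partial>PiM {1..p} (\<lambda>_. M)) = 1"
    and f_measurable:
      "(\<lambda>(x, z, \<theta>). f x z \<theta>) \<in> borel_measurable (M \<Otimes>\<^sub>M PiM {1..p} (\<lambda>_. M) \<Otimes>\<^sub>M N)"
    and f_nonneg:
      "\<And>x z \<theta>. x \<in> space M \<Longrightarrow> z \<in> space (PiM {1..p} (\<lambda>_. M)) \<Longrightarrow> \<theta> \<in> space N \<Longrightarrow> f x z \<theta> \<ge> 0"
    and f_integral:
      "\<And>z \<theta>. z \<in> space (PiM {1..p} (\<lambda>_. M)) \<Longrightarrow> \<theta> \<in> space N \<Longrightarrow>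
        (\<integral>\<^sup>+ x. ennreal (f x z \<theta>) \<partial>M) = 1"

text \<open>The sigma-algebra generated by \<open>X 1, ..., X n\<close>.\<close>

definition past_algebra ::
  "'x measure \<Rightarrow> 'w measure \<Rightarrow> (nat \<Rightarrow> 'w \<Rightarrow> 'x) \<Rightarrow> nat \<Rightarrow> 'w measure" where
  "past_algebra M \<Omega> X n =
    vimage_algebra (space \<Omega>) (\<lambda>\<omega>. history n (\<lambda>t. X t \<omega>)) (PiM {1..n} (\<lambda>_. M))"

text \<open>\<open>P \<theta>\<close> is the law of the series with parameter \<open>\<theta>\<close>, a probability measure on the
  measurable space underlying \<open>\<Omega>\<close>.\<close>

locale ar_time_series = ar_densities M N p f0 f
  for M :: "'x measure" and N :: "'t measure" and p f0 f +
  fixes \<Omega> :: "'w measure" and P :: "'t \<Rightarrow> 'w measure" and X :: "nat \<Rightarrow> 'w \<Rightarrow> 'x"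
  assumes X_measurable: "\<And>t. t \<ge> 1 \<Longrightarrow> X t \<in> measurable \<Omega> M"
    and P_prob_space: "\<And>\<theta>. \<theta> \<in> space N \<Longrightarrow> prob_space (P \<theta>)"
    and P_sets: "\<And>\<theta>. \<theta> \<in> space N \<Longrightarrow> sets (P \<theta>) = sets \<Omega>"
    and initial_density:
      "\<And>\<theta>. \<theta> \<in> space N \<Longrightarrow>
        distributed (P \<theta>) (PiM {1..p} (\<lambda>_. M)) (\<lambda>\<omega>. history p (\<lambda>t. X t \<omega>)) (\<lambda>x. f0 x \<theta>)"
    and conditional_density:
      "\<And>\<theta> t A. \<theta> \<in> space N \<Longrightarrow> t > p \<Longrightarrow> A \<in> sets M \<Longrightarrow>
        AE \<omega> in P \<theta>.
          nn_cond_exp (P \<theta>) (past_algebra M \<Omega> X (t - 1)) (\<lambda>\<omega>. indicator A (X t \<omega>)) \<omega>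
          = (\<integral>\<^sup>+ x\<in>A. ennreal (f x (lags p (\<lambda>s. X s \<omega>) t) \<theta>) \<partial>M)"

text \<open>\<open>\<Theta> T (x 1, ..., x T)\<close> is the estimate from the first \<open>T\<close> observations, for \<open>T \<ge> p\<close>.\<close>

definition nonanticipatory_estimators ::
  "'x measure \<Rightarrow> 't measure \<Rightarrow> nat \<Rightarrow> (nat \<Rightarrow> (nat \<Rightarrow> 'x) \<Rightarrow> 't) \<Rightarrow> bool" where
  "nonanticipatory_estimators M N p \<Theta> \<longleftrightarrow>
    (\<forall>T\<ge>p. \<Theta> T \<in> measurable (PiM {1..T} (\<lambda>_. M)) N)"

text \<open>The zero-denominator case is explicit because \<open>0 / 0 = 0\<close> in type ennreal, whereas here
  the ratio must be infinite.\<close>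

definition lik_ratio ::
  "nat \<Rightarrow> ('x \<Rightarrow> (nat \<Rightarrow> 'x) \<Rightarrow> 't \<Rightarrow> real) \<Rightarrow> (nat \<Rightarrow> (nat \<Rightarrow> 'x) \<Rightarrow> 't) \<Rightarrow>
    (nat \<Rightarrow> 'x) \<Rightarrow> nat \<Rightarrow> 't \<Rightarrow> ennreal" where
  "lik_ratio p f \<Theta> x T \<theta> =
    (if T \<le> p then 1
     else let num = (\<Prod>t=p+1..T. f (x t) (lags p x t) (\<Theta> (t - 1) (history (t - 1) x)));
              den = (\<Prod>t=p+1..T. f (x t) (lags p x t) \<theta>)
          in if den = 0 then \<infinity> else ennreal (num / den))"

definition confidence_set ::
  "'t measure \<Rightarrow> nat \<Rightarrow> ('x \<Rightarrow> (nat \<Rightarrow> 'x) \<Rightarrow> 't \<Rightarrow> real) \<Rightarrow> (nat \<Rightarrow> (nat \<Rightarrow> 'x) \<Rightarrow> 't) \<Rightarrow>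
    real \<Rightarrow> (nat \<Rightarrow> 'x) \<Rightarrow> nat \<Rightarrow> 't set" where
  "confidence_set N p f \<Theta> \<alpha> x T =
    {\<theta> \<in> space N. lik_ratio p f \<Theta> x T \<theta> \<le> ennreal (1 / \<alpha>)}"

end

theory Submission
  imports Defs
begin

text \<open>Under \<open>P \<theta>\<^sub>0\<close> the quotients form a nonnegative supermartingale started at 1: integrating
  the next factor \<open>f(x | z; \<Theta>) / f(x | z; \<theta>\<^sub>0)\<close> against the density \<open>f(x | z; \<theta>\<^sub>0)\<close> gives at most
  \<open>\<integral> f(x | z; \<Theta>) dx = 1\<close>, because the estimate depends on the past only. Ville's maximal
  inequality then bounds the probability that the quotient ever reaches \<open>1 / \<alpha>\<close> by \<open>\<alpha>\<close>, and the
  denominators vanish with probability zero.\<close>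

section \<open>Ville's maximal inequality\<close>

text \<open>Stop the process when it first reaches \<open>c\<close>: the stopped process still has
  integral at most that of \<open>Y 0\<close>, and it is at least \<open>c\<close> wherever the
  level was reached. The supermartingale property is phrased through integrals over past events,
  which makes sense for extended nonnegative values.\<close>

lemma ville_inequality:
  fixes Y :: "nat \<Rightarrow> 'a \<Rightarrow> ennreal" and F :: "nat \<Rightarrow> 'a measure" and c :: ennreal
  assumes subalg: "\<And>n. subalgebra Q (F n)"
    and mono: "\<And>n. sets (F n) \<subseteq> sets (F (Suc n))"
    and adapted: "\<And>n. Y n \<in> borel_measurable (F n)"
    and supermartingale:
      "\<And>n B. B \<in> sets (F n) \<Longrightarrow> (\<integral>\<^sup>+\<omega>\<in>B. Y (Suc n) \<omega> \<partial>Q) \<le> (\<integral>\<^sup>+\<omega>\<in>B. Y n \<omega> \<partial>Q)"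
  shows "c * emeasure Q {\<omega> \<in> space Q. \<exists>n. c \<le> Y n \<omega>} \<le> (\<integral>\<^sup>+\<omega>. Y 0 \<omega> \<partial>Q)"
proof -
  define A where "A n = {\<omega> \<in> space Q. \<exists>k\<le>n. c \<le> Y k \<omega>}" for n
  have space_F: "space (F n) = space Q" for n
    using subalg by (auto simp: subalgebra_def)
  have F_mono: "sets (F k) \<subseteq> sets (F n)" if "k \<le> n" for k n
    using that by (induction n rule: dec_induct) (use mono in auto)
  have level: "{\<omega> \<in> space Q. c \<le> Y k \<omega>} \<in> sets (F k)" for k
    using adapted[of k] unfolding space_F[of k, symmetric] by measurable
  have A_F: "A n \<in> sets (F n)" for n
  proof -
    have "A n = (\<Union>k\<le>n. {\<omega> \<in> space Q. c \<le> Y k \<omega>})"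
      unfolding A_def by auto
    also have "\<dots> \<in> sets (F n)"
      using level F_mono by (intro sets.finite_UN) auto
    finally show ?thesis .
  qed
  have F_Q: "sets (F n) \<subseteq> sets Q" for n
    using subalg by (auto simp: subalgebra_def)
  have A_Q[measurable]: "A n \<in> sets Q" for n
    using A_F F_Q by blast
  have Y_Q[measurable]: "Y n \<in> borel_measurable Q" for n
    using adapted subalg measurable_from_subalg by blast
  \<comment> \<open>The left side is a lower bound for the integral of \<open>Y\<close> stopped at
    level \<open>c\<close> or at time \<open>n\<close>: on \<open>A n\<close> the stopped value is
    replaced by \<open>c\<close>, elsewhere it is still \<open>Y n\<close>.\<close>
  have key: "c * emeasure Q (A n) + (\<integral>\<^sup>+\<omega>\<in>space Q - A n. Y n \<omega> \<partial>Q) \<le> (\<integral>\<^sup>+\<omega>. Y 0 \<omega> \<partial>Q)" for n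
  proof (induction n)
    case 0
    have "c * emeasure Q (A 0) + (\<integral>\<^sup>+\<omega>\<in>space Q - A 0. Y 0 \<omega> \<partial>Q)
        = (\<integral>\<^sup>+\<omega>. c * indicator (A 0) \<omega> + Y 0 \<omega> * indicator (space Q - A 0) \<omega> \<partial>Q)"
      by (subst nn_integral_add) (auto simp: nn_integral_cmult_indicator)
    also have "\<dots> \<le> (\<integral>\<^sup>+\<omega>. Y 0 \<omega> \<partial>Q)"
      by (intro nn_integral_mono) (auto simp: A_def indicator_def)
    finally show ?case .
  next
    case (Suc n)
    let ?C = "A (Suc n) - A n"
    have "emeasure Q (A (Suc n)) = emeasure Q (A n) + emeasure Q ?C"
      by (subst plus_emeasure) (auto simp: A_def intro: le_SucI intro!: arg_cong[where f = "emeasure Q"])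
    then have "c * emeasure Q (A (Suc n)) + (\<integral>\<^sup>+\<omega>\<in>space Q - A (Suc n). Y (Suc n) \<omega> \<partial>Q)
        = c * emeasure Q (A n)
          + (c * emeasure Q ?C + (\<integral>\<^sup>+\<omega>\<in>space Q - A (Suc n). Y (Suc n) \<omega> \<partial>Q))"
      by (simp add: distrib_left add.assoc)
    also have "c * emeasure Q ?C + (\<integral>\<^sup>+\<omega>\<in>space Q - A (Suc n). Y (Suc n) \<omega> \<partial>Q)
        = (\<integral>\<^sup>+\<omega>. c * indicator ?C \<omega> + Y (Suc n) \<omega> * indicator (space Q - A (Suc n)) \<omega> \<partial>Q)"
      by (subst nn_integral_add) (auto simp: nn_integral_cmult_indicator)
    \<comment> \<open>On \<open>?C\<close> the level is reached exactly at time
      \<open>Suc n\<close>, so there \<open>c\<close> is at most \<open>Y (Suc n)\<close>.\<close>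
    also have "\<dots> \<le> (\<integral>\<^sup>+\<omega>\<in>space Q - A n. Y (Suc n) \<omega> \<partial>Q)"
      by (intro nn_integral_mono) (auto simp: A_def indicator_def le_Suc_eq)
    \<comment> \<open>Not having stopped by time \<open>n\<close> is an event of \<open>F n\<close>,
      so the one-step hypothesis applies to it.\<close>
    also have "\<dots> \<le> (\<integral>\<^sup>+\<omega>\<in>space Q - A n. Y n \<omega> \<partial>Q)"
      using A_F[of n] sets.compl_sets[of "A n" "F n"] space_F[of n]
      by (intro supermartingale) auto
    also note Suc.IH
    finally show ?case
      by (simp add: add_left_mono)
  qed
  have "emeasure Q {\<omega> \<in> space Q. \<exists>n. c \<le> Y n \<omega>} = emeasure Q (\<Union>n. A n)"
    by (rule arg_cong[where f = "emeasure Q"]) (auto simp: A_def)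
  also have "\<dots> = (SUP n. emeasure Q (A n))"
    by (intro SUP_emeasure_incseq[symmetric]) (auto simp: incseq_def A_def intro: order_trans)
  finally have "c * emeasure Q {\<omega> \<in> space Q. \<exists>n. c \<le> Y n \<omega>} = (SUP n. c * emeasure Q (A n))"
    by (simp add: SUP_mult_left_ennreal)
  also have "\<dots> \<le> (\<integral>\<^sup>+\<omega>. Y 0 \<omega> \<partial>Q)"
    using key by (intro SUP_least) (rule order_trans[OF add_increasing2], auto)
  finally show ?thesis .
qed

section \<open>Integration against a conditional density\<close>

text \<open>The hypothesis \<open>cond\<close> speaks of one set \<open>A\<close> at a time. It
  determines the joint law of the past and \<open>Z\<close> on rectangles, hence everywhere, and so
  extends to integrands that depend on the past and on \<open>Z\<close> together. The past is
  represented by \<omega> itself, seen through \<open>G\<close>.\<close>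

lemma nn_integral_conditional_density:
  fixes k :: "'w \<times> 'x \<Rightarrow> ennreal"
  assumes "prob_space Q" and subalg: "subalgebra Q G" and "sigma_finite_measure M"
    and Z: "Z \<in> measurable Q M"
    and k[measurable]: "k \<in> borel_measurable (G \<Otimes>\<^sub>M M)"
    and cond: "\<And>A. A \<in> sets M \<Longrightarrow>
      AE \<omega> in Q. nn_cond_exp Q G (\<lambda>\<omega>. indicator A (Z \<omega>)) \<omega> = (\<integral>\<^sup>+x\<in>A. k (\<omega>, x) \<partial>M)"
    and g[measurable]: "g \<in> borel_measurable (G \<Otimes>\<^sub>M M)"
  shows "(\<integral>\<^sup>+\<omega>. g (\<omega>, Z \<omega>) \<partial>Q) = (\<integral>\<^sup>+\<omega>. (\<integral>\<^sup>+x. k (\<omega>, x) * g (\<omega>, x) \<partial>M) \<partial>Q)"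
proof -
  interpret Q: prob_space Q by fact
  interpret M: sigma_finite_measure M by fact
  interpret G: finite_measure_subalgebra Q G
    by unfold_locales (fact subalg)
  \<comment> \<open>Since \<open>k\<close> and \<open>g\<close> are measurable with respect to
    \<open>G\<close> only, the product measure is built from the restriction of \<open>Q\<close> to
    \<open>G\<close>.\<close>
  let ?R = "restr_to_subalg Q G"
  have sets_R[measurable_cong]: "sets ?R = sets G"
    by (rule sets_restr_to_subalg[OF subalg])
  have space_G: "space G = space Q"
    using subalg by (simp add: subalgebra_def)
  have id[measurable]: "(\<lambda>\<omega>. \<omega>) \<in> measurable Q G"
    by (rule measurable_from_subalg[OF subalg measurable_ident_sets[OF refl]])
  note Z[measurable]
  let ?\<mu> = "distr Q (G \<Otimes>\<^sub>M M) (\<lambda>\<omega>. (\<omega>, Z \<omega>))"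
  let ?\<nu> = "density (?R \<Otimes>\<^sub>M M) k"
  have sets_RM: "sets (?R \<Otimes>\<^sub>M M) = sets (G \<Otimes>\<^sub>M M)"
    by (intro sets_pair_measure_cong sets_R refl)
  have k_R[measurable]: "k \<in> borel_measurable (?R \<Otimes>\<^sub>M M)"
    and g_R[measurable]: "g \<in> borel_measurable (?R \<Otimes>\<^sub>M M)"
    by measurable
  \<comment> \<open>Tonelli's theorem leaves an outer integrand measurable for \<open>G\<close>,
    whose integral is the same under \<open>?R\<close> and \<open>Q\<close>.\<close>
  have iterate: "(\<integral>\<^sup>+y. h y \<partial>(?R \<Otimes>\<^sub>M M)) = (\<integral>\<^sup>+\<omega>. (\<integral>\<^sup>+x. h (\<omega>, x) \<partial>M) \<partial>Q)"
    if h[measurable]: "h \<in> borel_measurable (G \<Otimes>\<^sub>M M)" for h :: "'w \<times> 'x \<Rightarrow> ennreal"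
  proof -
    have "(\<integral>\<^sup>+y. h y \<partial>(?R \<Otimes>\<^sub>M M)) = (\<integral>\<^sup>+\<omega>. (\<integral>\<^sup>+x. h (\<omega>, x) \<partial>M) \<partial>?R)"
      by (rule M.nn_integral_fst[symmetric]) measurable
    also have "\<dots> = (\<integral>\<^sup>+\<omega>. (\<integral>\<^sup>+x. h (\<omega>, x) \<partial>M) \<partial>Q)"
      by (rule nn_integral_subalgebra2[OF subalg]) measurable
    finally show ?thesis .
  qed
  have rect: "emeasure ?\<mu> (B \<times> A) = emeasure ?\<nu> (B \<times> A)"
    if B[measurable]: "B \<in> sets G" and A[measurable]: "A \<in> sets M" for A B
  proof -
    have BQ[measurable]: "B \<in> sets Q"
      using B subalg by (auto simp: subalgebra_def)
    have "emeasure ?\<mu> (B \<times> A) = (\<integral>\<^sup>+\<omega>. indicator B \<omega> * indicator A (Z \<omega>) \<partial>Q)"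
    proof -
      have "emeasure ?\<mu> (B \<times> A) = (\<integral>\<^sup>+y. indicator (B \<times> A) y \<partial>?\<mu>)"
        by simp
      also have "\<dots> = (\<integral>\<^sup>+\<omega>. indicator (B \<times> A) (\<omega>, Z \<omega>) \<partial>Q)"
        by (rule nn_integral_distr) measurable
      finally show ?thesis
        by (simp add: indicator_times)
    qed
    \<comment> \<open>This is the defining property of conditional expectation, with the indicator
      of \<open>B\<close> as the test function measurable for \<open>G\<close>.\<close>
    also have "\<dots> = (\<integral>\<^sup>+\<omega>. indicator B \<omega> * nn_cond_exp Q G (\<lambda>\<omega>. indicator A (Z \<omega>)) \<omega> \<partial>Q)"
      by (rule G.nn_cond_exp_intg[symmetric]) measurable
    also have "\<dots> = (\<integral>\<^sup>+\<omega>. indicator B \<omega> * (\<integral>\<^sup>+x\<in>A. k (\<omega>, x) \<partial>M) \<partial>Q)"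
      using cond[OF A] by (intro nn_integral_cong_AE) auto
    also have "\<dots> = (\<integral>\<^sup>+\<omega>. (\<integral>\<^sup>+x. k (\<omega>, x) * indicator (B \<times> A) (\<omega>, x) \<partial>M) \<partial>Q)"
      by (intro nn_integral_cong) (auto simp: indicator_times indicator_def)
    also have "\<dots> = (\<integral>\<^sup>+y. k y * indicator (B \<times> A) y \<partial>(?R \<Otimes>\<^sub>M M))"
      by (rule iterate[symmetric]) measurable
    also have "\<dots> = emeasure ?\<nu> (B \<times> A)"
      by (rule emeasure_density[symmetric]) (auto simp: sets_RM)
    finally show ?thesis .
  qed
  have "?\<mu> = ?\<nu>"
  \<comment> \<open>Rectangles are stable under intersection and generate the product. As
    \<open>?\<mu>\<close> is a probability measure, the whole space, repeated, serves as the
    exhausting sequence of sets of finite measure.\<close>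
  proof (rule measure_eqI_generator_eq[where
        E = "{B \<times> A | B A. B \<in> sets G \<and> A \<in> sets M}" and \<Omega> = "space G \<times> space M"
        and A = "\<lambda>_::nat. space G \<times> space M"])
    show "Int_stable {B \<times> A | B A. B \<in> sets G \<and> A \<in> sets M}"
      by (rule Int_stable_pair_measure_generator)
    show "{B \<times> A | B A. B \<in> sets G \<and> A \<in> sets M} \<subseteq> Pow (space G \<times> space M)"
      by (rule pair_measure_closed)
    show "sets ?\<mu> = sigma_sets (space G \<times> space M) {B \<times> A | B A. B \<in> sets G \<and> A \<in> sets M}"
      by (simp add: sets_pair_measure)
    then show "sets ?\<nu> = sigma_sets (space G \<times> space M) {B \<times> A | B A. B \<in> sets G \<and> A \<in> sets M}"
      by (simp add: sets_RM)
    interpret D: prob_space ?\<mu>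
      by (rule Q.prob_space_distr) measurable
    show "emeasure ?\<mu> (space G \<times> space M) \<noteq> \<infinity>" for i :: nat
      unfolding infinity_ennreal_def by (rule D.emeasure_finite)
  qed (use rect in auto)
  then have "(\<integral>\<^sup>+y. g y \<partial>?\<mu>) = (\<integral>\<^sup>+y. g y \<partial>?\<nu>)"
    by simp
  moreover have "(\<integral>\<^sup>+y. g y \<partial>?\<mu>) = (\<integral>\<^sup>+\<omega>. g (\<omega>, Z \<omega>) \<partial>Q)"
    by (rule nn_integral_distr) measurable
  moreover have "(\<integral>\<^sup>+y. g y \<partial>?\<nu>) = (\<integral>\<^sup>+y. k y * g y \<partial>(?R \<Otimes>\<^sub>M M))"
    by (rule nn_integral_density) measurable
  moreover have "\<dots> = (\<integral>\<^sup>+\<omega>. (\<integral>\<^sup>+x. k (\<omega>, x) * g (\<omega>, x) \<partial>M) \<partial>Q)"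
    by (rule iterate) measurable
  ultimately show ?thesis
    by simp
qed

section \<open>Histories, lags and the filtration of the series\<close>

lemma history_measurable:
  assumes "\<And>s. 1 \<le> s \<Longrightarrow> s \<le> n \<Longrightarrow> X s \<in> measurable G M"
  shows "(\<lambda>\<omega>. history n (\<lambda>t. X t \<omega>)) \<in> measurable G (PiM {1..n} (\<lambda>_. M))"
  unfolding history_def by (rule measurable_restrict) (use assms in auto)

lemma lags_measurable:
  assumes "p < t" and "\<And>s. 1 \<le> s \<Longrightarrow> s < t \<Longrightarrow> X s \<in> measurable G M"
  shows "(\<lambda>\<omega>. lags p (\<lambda>s. X s \<omega>) t) \<in> measurable G (PiM {1..p} (\<lambda>_. M))"
  \<comment> \<open>For \<open>p < t\<close> the index \<open>t - p - 1 + i\<close> runs from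
    \<open>t - p\<close>, which is at least 1, up to \<open>t - 1\<close>.\<close>
  unfolding lags_def by (rule measurable_restrict) (use assms in auto)

context ar_time_series
begin

lemma space_P: "\<theta> \<in> space N \<Longrightarrow> space (P \<theta>) = space \<Omega>"
  using P_sets sets_eq_imp_space_eq by blast

lemma space_past_algebra: "space (past_algebra M \<Omega> X n) = space \<Omega>"
  by (simp add: past_algebra_def)

lemma subalgebra_past_algebra: "\<theta> \<in> space N \<Longrightarrow> subalgebra (P \<theta>) (past_algebra M \<Omega> X n)"
proof -
  assume \<theta>: "\<theta> \<in> space N"
  have "(\<lambda>\<omega>. history n (\<lambda>t. X t \<omega>)) \<in> measurable (P \<theta>) (PiM {1..n} (\<lambda>_. M))"
    using X_measurable measurable_cong_sets[OF P_sets[OF \<theta>] refl]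
    by (intro history_measurable) auto
  then have "sets (past_algebra M \<Omega> X n) \<subseteq> sets (P \<theta>)"
    unfolding past_algebra_def space_P[OF \<theta>, symmetric]
    by (auto simp: measurable_iff_sets)
  then show ?thesis
    by (simp add: subalgebra_def space_P[OF \<theta>] space_past_algebra)
qed

lemma past_measurable:
  assumes "1 \<le> s" "s \<le> n"
  shows "X s \<in> measurable (past_algebra M \<Omega> X n) M"
proof -
  have "(\<lambda>\<omega>. history n (\<lambda>t. X t \<omega>)) \<in> measurable (past_algebra M \<Omega> X n) (PiM {1..n} (\<lambda>_. M))"
    unfolding past_algebra_def
    using measurable_space[OF history_measurable[where G = \<Omega> and n = n and X = X]] X_measurable
    by (intro measurable_vimage_algebra1) auto
  moreover have "(\<lambda>x. x s) \<in> measurable (PiM {1..n} (\<lambda>_. M)) M"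
    by (rule measurable_component_singleton) (use assms in simp)
  ultimately have "(\<lambda>\<omega>. history n (\<lambda>t. X t \<omega>) s) \<in> measurable (past_algebra M \<Omega> X n) M"
    by (rule measurable_compose)
  then show ?thesis
    using assms by (simp add: history_def)
qed

text \<open>A past algebra is the smallest one making its \<open>history\<close> measurable, and the
  shorter history is already measurable for the next past algebra.\<close>

lemma sets_past_algebra_mono: "sets (past_algebra M \<Omega> X n) \<subseteq> sets (past_algebra M \<Omega> X (Suc n))"
proof -
  have "(\<lambda>\<omega>. history n (\<lambda>t. X t \<omega>)) \<in>
      measurable (past_algebra M \<Omega> X (Suc n)) (PiM {1..n} (\<lambda>_. M))"
    by (intro history_measurable past_measurable) auto
  then show ?thesis
    unfolding past_algebra_def by (simp add: measurable_iff_sets)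
qed

lemma f_compose_measurable:
  assumes "u \<in> measurable G M" "z \<in> measurable G (PiM {1..p} (\<lambda>_. M))" "h \<in> measurable G N"
  shows "(\<lambda>\<omega>. f (u \<omega>) (z \<omega>) (h \<omega>)) \<in> borel_measurable G"
proof -
  have "(\<lambda>\<omega>. (u \<omega>, z \<omega>, h \<omega>)) \<in> measurable G (M \<Otimes>\<^sub>M PiM {1..p} (\<lambda>_. M) \<Otimes>\<^sub>M N)"
    using assms by measurable
  from measurable_compose[OF this f_measurable] show ?thesis
    by simp
qed

end

section \<open>The factors of the quotient and their product\<close>

locale ar_sequential_estimation = ar_time_series M N p f0 f \<Omega> P X
  for M :: "'x measure" and N :: "'t measure" and p f0 f and \<Omega> :: "'w measure" and P X +
  fixes \<Theta> :: "nat \<Rightarrow> (nat \<Rightarrow> 'x) \<Rightarrow> 't" and \<theta>\<^sub>0 :: 't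
  assumes estimators: "nonanticipatory_estimators M N p \<Theta>"
    and \<theta>\<^sub>0: "\<theta>\<^sub>0 \<in> space N"
begin

text \<open>The argument \<open>x\<close> stands in for the observation at time \<open>t\<close>.
  For \<open>p < t\<close>, \<omega> enters only through earlier observations, so the factor can be
  integrated over \<open>x\<close> with the past held fixed.\<close>

definition next_numerator :: "nat \<Rightarrow> 'w \<Rightarrow> 'x \<Rightarrow> real" where
  "next_numerator t \<omega> x =
    f x (lags p (\<lambda>s. X s \<omega>) t) (\<Theta> (t - 1) (history (t - 1) (\<lambda>s. X s \<omega>)))"

definition next_denominator :: "nat \<Rightarrow> 'w \<Rightarrow> 'x \<Rightarrow> real" where
  "next_denominator t \<omega> x = f x (lags p (\<lambda>s. X s \<omega>) t) \<theta>\<^sub>0"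

text \<open>Differs from \<^const>\<open>lik_ratio\<close> only where a denominator vanishes: there it is 0.\<close>

definition quotient_process :: "nat \<Rightarrow> 'w \<Rightarrow> ennreal" where
  "quotient_process T \<omega> =
    (\<Prod>t=p+1..T. ennreal (next_numerator t \<omega> (X t \<omega>) / next_denominator t \<omega> (X t \<omega>)))"

lemma \<Theta>_history_measurable:
  assumes "p < t" and "\<And>s. 1 \<le> s \<Longrightarrow> s < t \<Longrightarrow> X s \<in> measurable G M"
  shows "(\<lambda>\<omega>. \<Theta> (t - 1) (history (t - 1) (\<lambda>s. X s \<omega>))) \<in> measurable G N"
proof (rule measurable_compose[OF history_measurable])
  show "\<Theta> (t - 1) \<in> measurable (PiM {1..t - 1} (\<lambda>_. M)) N"
    using estimators assms(1) by (auto simp: nonanticipatory_estimators_def)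
qed (use assms in auto)

text \<open>The map \<open>v\<close> supplies the past and \<open>u\<close> the next observation.
  This covers both the factor evaluated along a path, with \<open>v\<close> the identity and
  \<open>u\<close> equal to \<open>X t\<close>, and the factor on the product space, with the two
  projections.\<close>

lemma next_numerator_measurable:
  assumes "p < t" "\<And>s. 1 \<le> s \<Longrightarrow> s < t \<Longrightarrow> X s \<in> measurable G M"
    and u: "u \<in> measurable H M" and v: "v \<in> measurable H G"
  shows "(\<lambda>y. next_numerator t (v y) (u y)) \<in> borel_measurable H"
  unfolding next_numerator_def
  by (intro f_compose_measurable u measurable_compose[OF v lags_measurable]
      measurable_compose[OF v \<Theta>_history_measurable] assms)

lemma next_denominator_measurable:
  assumes "p < t" "\<And>s. 1 \<le> s \<Longrightarrow> s < t \<Longrightarrow> X s \<in> measurable G M"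
    and u: "u \<in> measurable H M" and v: "v \<in> measurable H G"
  shows "(\<lambda>y. next_denominator t (v y) (u y)) \<in> borel_measurable H"
  unfolding next_denominator_def
  by (intro f_compose_measurable u measurable_compose[OF v lags_measurable] assms
      measurable_const \<theta>\<^sub>0)

lemma quotient_process_measurable:
  assumes "\<And>s. 1 \<le> s \<Longrightarrow> s \<le> T \<Longrightarrow> X s \<in> measurable G M"
  shows "quotient_process T \<in> borel_measurable G"
proof -
  have "(\<lambda>\<omega>. ennreal (next_numerator t \<omega> (X t \<omega>) / next_denominator t \<omega> (X t \<omega>)))
      \<in> borel_measurable G" if "t \<in> {p+1..T}" for t
    using that assms
    by (intro measurable_compose[OF _ measurable_ennreal] borel_measurable_divide
        next_numerator_measurable[where G = G] next_denominator_measurable[where G = G]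
        measurable_ident_sets[OF refl]) auto
  then show ?thesis
    unfolding quotient_process_def by (intro borel_measurable_prod_ennreal) auto
qed

lemma lags_space:
  "p < t \<Longrightarrow> \<omega> \<in> space \<Omega> \<Longrightarrow> lags p (\<lambda>s. X s \<omega>) t \<in> space (PiM {1..p} (\<lambda>_. M))"
  by (rule measurable_space[OF lags_measurable]) (auto intro: X_measurable)

lemma \<Theta>_space:
  "p < t \<Longrightarrow> \<omega> \<in> space \<Omega> \<Longrightarrow> \<Theta> (t - 1) (history (t - 1) (\<lambda>s. X s \<omega>)) \<in> space N"
  by (rule measurable_space[OF \<Theta>_history_measurable]) (auto intro: X_measurable)

lemma next_numerator_nonneg:
  "p < t \<Longrightarrow> \<omega> \<in> space \<Omega> \<Longrightarrow> x \<in> space M \<Longrightarrow> 0 \<le> next_numerator t \<omega> x"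
  unfolding next_numerator_def by (intro f_nonneg lags_space \<Theta>_space)

lemma next_denominator_nonneg:
  "p < t \<Longrightarrow> \<omega> \<in> space \<Omega> \<Longrightarrow> x \<in> space M \<Longrightarrow> 0 \<le> next_denominator t \<omega> x"
  unfolding next_denominator_def by (intro f_nonneg lags_space \<theta>\<^sub>0)

text \<open>Here non-anticipation is decisive: the estimate is the same for every \<open>x\<close>,
  so the integrand is a single conditional density.\<close>

lemma nn_integral_next_numerator:
  "p < t \<Longrightarrow> \<omega> \<in> space \<Omega> \<Longrightarrow> (\<integral>\<^sup>+x. ennreal (next_numerator t \<omega> x) \<partial>M) = 1"
  unfolding next_numerator_def by (intro f_integral lags_space \<Theta>_space)

lemma next_measurable_pair:
  assumes "p < t"
  shows "(\<lambda>y. next_numerator t (fst y) (snd y))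
      \<in> borel_measurable (past_algebra M \<Omega> X (t - 1) \<Otimes>\<^sub>M M)"
    and "(\<lambda>y. next_denominator t (fst y) (snd y))
      \<in> borel_measurable (past_algebra M \<Omega> X (t - 1) \<Otimes>\<^sub>M M)"
  using assms
  by (auto intro!: past_measurable next_denominator_measurable[OF _ _ measurable_snd measurable_fst]
      next_numerator_measurable[OF _ _ measurable_snd measurable_fst])

section \<open>One-step integration and the supermartingale property\<close>

text \<open>Under \<open>P \<theta>\<^sub>0\<close> the function
  \<open>next_denominator t \<omega>\<close> is the conditional density of \<open>X t\<close> given
  the past, so the general integration formula applies.\<close>

lemma nn_integral_next:
  assumes t: "p < t"
    and g: "g \<in> borel_measurable (past_algebra M \<Omega> X (t - 1) \<Otimes>\<^sub>M M)"
  shows "(\<integral>\<^sup>+\<omega>. g (\<omega>, X t \<omega>) \<partial>P \<theta>\<^sub>0)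
    = (\<integral>\<^sup>+\<omega>. (\<integral>\<^sup>+x. ennreal (next_denominator t \<omega> x) * g (\<omega>, x) \<partial>M) \<partial>P \<theta>\<^sub>0)"
proof -
  have "(\<lambda>y. ennreal (next_denominator t (fst y) (snd y)))
      \<in> borel_measurable (past_algebra M \<Omega> X (t - 1) \<Otimes>\<^sub>M M)"
    using next_measurable_pair(2)[OF t] by measurable
  moreover have "AE \<omega> in P \<theta>\<^sub>0.
      nn_cond_exp (P \<theta>\<^sub>0) (past_algebra M \<Omega> X (t - 1)) (\<lambda>\<omega>. indicator A (X t \<omega>)) \<omega>
      = (\<integral>\<^sup>+x\<in>A. ennreal (next_denominator t (fst (\<omega>, x)) (snd (\<omega>, x))) \<partial>M)"
    if "A \<in> sets M" for A
    using conditional_density[OF \<theta>\<^sub>0 t that] by (simp add: next_denominator_def)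
  moreover have "X t \<in> measurable (P \<theta>\<^sub>0) M"
    using X_measurable[of t] t measurable_cong_sets[OF P_sets[OF \<theta>\<^sub>0] refl] by auto
  ultimately show ?thesis
    using nn_integral_conditional_density[OF P_prob_space[OF \<theta>\<^sub>0] subalgebra_past_algebra[OF \<theta>\<^sub>0]
        sigma_finite_measure_axioms _ _ _ g]
    by simp
qed

text \<open>A density gives no mass to its own zero set: its product with the indicator of that set
  is identically 0.\<close>

lemma AE_next_denominator_nonzero:
  assumes t: "p < t"
  shows "AE \<omega> in P \<theta>\<^sub>0. next_denominator t \<omega> (X t \<omega>) \<noteq> 0"
proof -
  let ?g = "\<lambda>y. indicator {0::real} (next_denominator t (fst y) (snd y)) :: ennreal"
  have "?g \<in> borel_measurable (past_algebra M \<Omega> X (t - 1) \<Otimes>\<^sub>M M)"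
    using next_measurable_pair(2)[OF t] by measurable
  then have "(\<integral>\<^sup>+\<omega>. ?g (\<omega>, X t \<omega>) \<partial>P \<theta>\<^sub>0)
    = (\<integral>\<^sup>+\<omega>. (\<integral>\<^sup>+x. ennreal (next_denominator t \<omega> x) * ?g (\<omega>, x) \<partial>M) \<partial>P \<theta>\<^sub>0)"
    by (rule nn_integral_next[OF t])
  also have "\<dots> = (\<integral>\<^sup>+\<omega>. (\<integral>\<^sup>+x. 0 \<partial>M) \<partial>P \<theta>\<^sub>0)"
    by (intro nn_integral_cong) (auto simp: indicator_def)
  finally have zero: "(\<integral>\<^sup>+\<omega>. ?g (\<omega>, X t \<omega>) \<partial>P \<theta>\<^sub>0) = 0"
    by simp
  have "(\<lambda>\<omega>. next_denominator t \<omega> (X t \<omega>)) \<in> borel_measurable \<Omega>"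
    using t by (intro next_denominator_measurable[where G = \<Omega>] X_measurable
        measurable_ident_sets[OF refl]) auto
  then have "(\<lambda>\<omega>. next_denominator t \<omega> (X t \<omega>)) \<in> borel_measurable (P \<theta>\<^sub>0)"
    using measurable_cong_sets[OF P_sets[OF \<theta>\<^sub>0] refl] by auto
  then have "(\<lambda>\<omega>. ?g (\<omega>, X t \<omega>)) \<in> borel_measurable (P \<theta>\<^sub>0)"
    by simp
  from nn_integral_0_iff_AE[OF this] zero show ?thesis
    by (auto elim!: AE_mp simp: indicator_def split: if_splits)
qed

lemma quotient_process_supermartingale:
  assumes B: "B \<in> sets (past_algebra M \<Omega> X n)"
  shows "(\<integral>\<^sup>+\<omega>\<in>B. quotient_process (Suc n) \<omega> \<partial>P \<theta>\<^sub>0) \<le> (\<integral>\<^sup>+\<omega>\<in>B. quotient_process n \<omega> \<partial>P \<theta>\<^sub>0)"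
proof (cases "p \<le> n")
  \<comment> \<open>Here \<open>Suc n\<close> is at most \<open>p\<close>, so both products are
    empty.\<close>
  case False
  then show ?thesis
    by (simp add: quotient_process_def)
next
  case True
  let ?a = "next_numerator (Suc n)" and ?b = "next_denominator (Suc n)"
  \<comment> \<open>The weight \<open>?w\<close> is known at time \<open>n\<close>, hence constant
    in the integral over the next observation.\<close>
  let ?w = "\<lambda>\<omega>. quotient_process n \<omega> * indicator B \<omega>"
  let ?g = "\<lambda>y. ?w (fst y) * ennreal (?a (fst y) (snd y) / ?b (fst y) (snd y))"
  have w[measurable]: "?w \<in> borel_measurable (past_algebra M \<Omega> X n)"
    using B by (intro borel_measurable_times_ennreal quotient_process_measurable past_measurable) auto
  have ab[measurable]: "(\<lambda>y. ?a (fst y) (snd y)) \<in> borel_measurable (past_algebra M \<Omega> X n \<Otimes>\<^sub>M M)"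
    "(\<lambda>y. ?b (fst y) (snd y)) \<in> borel_measurable (past_algebra M \<Omega> X n \<Otimes>\<^sub>M M)"
    using next_measurable_pair[of "Suc n"] True by auto
  have g: "?g \<in> borel_measurable (past_algebra M \<Omega> X (Suc n - 1) \<Otimes>\<^sub>M M)"
    using measurable_compose[OF measurable_fst w] by simp
  have "(\<integral>\<^sup>+\<omega>\<in>B. quotient_process (Suc n) \<omega> \<partial>P \<theta>\<^sub>0) = (\<integral>\<^sup>+\<omega>. ?g (\<omega>, X (Suc n) \<omega>) \<partial>P \<theta>\<^sub>0)"
    using True by (simp add: quotient_process_def mult_ac)
  also have "\<dots> = (\<integral>\<^sup>+\<omega>. (\<integral>\<^sup>+x. ennreal (?b \<omega> x) * ?g (\<omega>, x) \<partial>M) \<partial>P \<theta>\<^sub>0)"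
    using True by (intro nn_integral_next g) auto
  also have "\<dots> \<le> (\<integral>\<^sup>+\<omega>. ?w \<omega> \<partial>P \<theta>\<^sub>0)"
  proof (rule nn_integral_mono)
    fix \<omega> assume "\<omega> \<in> space (P \<theta>\<^sub>0)"
    then have \<omega>: "\<omega> \<in> space \<Omega>"
      by (simp add: space_P \<theta>\<^sub>0)
    then have [measurable]: "?a \<omega> \<in> borel_measurable M"
      using measurable_Pair2[OF ab(1), of \<omega>] by (simp add: space_past_algebra)
    have "(\<integral>\<^sup>+x. ennreal (?b \<omega> x) * ?g (\<omega>, x) \<partial>M) \<le> (\<integral>\<^sup>+x. ?w \<omega> * ennreal (?a \<omega> x) \<partial>M)"
    proof (rule nn_integral_mono)
      fix x assume x: "x \<in> space M"
      \<comment> \<open>Equality holds where \<open>?b \<omega> x\<close> is positive. Where it is 0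
        the left side is 0 while the numerator may be positive, which is why only a supermartingale
        results.\<close>
      have "ennreal (?b \<omega> x) * ennreal (?a \<omega> x / ?b \<omega> x) \<le> ennreal (?a \<omega> x)"
        using True next_numerator_nonneg[OF _ \<omega> x, of "Suc n"]
          next_denominator_nonneg[OF _ \<omega> x, of "Suc n"]
        by (subst ennreal_mult[symmetric]) auto
      then have "?w \<omega> * (ennreal (?b \<omega> x) * ennreal (?a \<omega> x / ?b \<omega> x)) \<le> ?w \<omega> * ennreal (?a \<omega> x)"
        by (rule mult_left_mono) simp
      then show "ennreal (?b \<omega> x) * ?g (\<omega>, x) \<le> ?w \<omega> * ennreal (?a \<omega> x)"
        by (simp add: mult_ac)
    qed
    also have "\<dots> = ?w \<omega> * (\<integral>\<^sup>+x. ennreal (?a \<omega> x) \<partial>M)"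
      by (rule nn_integral_cmult) measurable
    also have "\<dots> = ?w \<omega>"
      using True \<omega> by (subst nn_integral_next_numerator) auto
    finally show "(\<integral>\<^sup>+x. ennreal (?b \<omega> x) * ?g (\<omega>, x) \<partial>M) \<le> ?w \<omega>" .
  qed
  finally show ?thesis .
qed

section \<open>Likelihood ratios and the probability of coverage\<close>

text \<open>With every denominator nonzero, the two conventions for a zero denominator do not come
  into play, and the product of quotients is the quotient of products. For \<open>T \<le> p\<close>
  the empty product gives 1.\<close>

lemma lik_ratio_eq_quotient_process:
  assumes \<omega>: "\<omega> \<in> space \<Omega>"
    and nz: "\<And>t. p < t \<Longrightarrow> next_denominator t \<omega> (X t \<omega>) \<noteq> 0"
  shows "lik_ratio p f \<Theta> (\<lambda>t. X t \<omega>) T \<theta>\<^sub>0 = quotient_process T \<omega>"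
proof -
  have "quotient_process T \<omega>
      = ennreal (\<Prod>t=p+1..T. next_numerator t \<omega> (X t \<omega>) / next_denominator t \<omega> (X t \<omega>))"
    unfolding quotient_process_def
    using next_numerator_nonneg next_denominator_nonneg \<omega> measurable_space[OF X_measurable \<omega>]
    by (intro prod_ennreal) auto
  moreover have "(\<Prod>t=p+1..T. next_denominator t \<omega> (X t \<omega>)) \<noteq> 0"
    using nz by auto
  ultimately show ?thesis
    by (simp add: lik_ratio_def Let_def prod_dividef next_numerator_def next_denominator_def)
qed

text \<open>Ensures that the coverage event is measurable, so that its probability can be compared
  with that of other events.\<close>

lemma lik_ratio_measurable:
  "(\<lambda>\<omega>. lik_ratio p f \<Theta> (\<lambda>t. X t \<omega>) T \<theta>\<^sub>0) \<in> borel_measurable \<Omega>"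
proof -
  have [measurable]: "(\<lambda>\<omega>. \<Prod>t=p+1..T. next_numerator t \<omega> (X t \<omega>)) \<in> borel_measurable \<Omega>"
    "(\<lambda>\<omega>. \<Prod>t=p+1..T. next_denominator t \<omega> (X t \<omega>)) \<in> borel_measurable \<Omega>"
    by (auto intro!: borel_measurable_prod X_measurable measurable_ident_sets[OF refl]
        next_numerator_measurable[where G = \<Omega>] next_denominator_measurable[where G = \<Omega>])
  have "(\<lambda>\<omega>. lik_ratio p f \<Theta> (\<lambda>t. X t \<omega>) T \<theta>\<^sub>0) = (\<lambda>\<omega>. if T \<le> p then 1 else
      if (\<Prod>t=p+1..T. next_denominator t \<omega> (X t \<omega>)) = 0 then \<infinity> else
      ennreal ((\<Prod>t=p+1..T. next_numerator t \<omega> (X t \<omega>))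
        / (\<Prod>t=p+1..T. next_denominator t \<omega> (X t \<omega>))))"
    unfolding lik_ratio_def Let_def next_numerator_def next_denominator_def ..
  also have "\<dots> \<in> borel_measurable \<Omega>"
    by measurable
  finally show ?thesis .
qed

lemma measure_confidence_set:
  assumes \<alpha>: "0 < \<alpha>"
  shows "measure (P \<theta>\<^sub>0)
      {\<omega> \<in> space (P \<theta>\<^sub>0). \<forall>T. \<theta>\<^sub>0 \<in> confidence_set N p f \<Theta> \<alpha> (\<lambda>t. X t \<omega>) T} \<ge> 1 - \<alpha>"
proof -
  interpret Q: prob_space "P \<theta>\<^sub>0"
    by (rule P_prob_space[OF \<theta>\<^sub>0])
  let ?c = "ennreal (1 / \<alpha>)"
  let ?L = "\<lambda>T \<omega>. lik_ratio p f \<Theta> (\<lambda>t. X t \<omega>) T \<theta>\<^sub>0"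
  \<comment> \<open>Ville's inequality bounds \<open>U\<close>, which concerns the quotient process;
    the claim concerns \<open>G\<close>, which is expressed by the likelihood ratio.\<close>
  define U where "U = {\<omega> \<in> space (P \<theta>\<^sub>0). \<exists>T. ?c \<le> quotient_process T \<omega>}"
  define G where "G = {\<omega> \<in> space (P \<theta>\<^sub>0). \<forall>T. ?L T \<omega> \<le> ?c}"
  have cong: "measurable (P \<theta>\<^sub>0) borel = measurable \<Omega> borel"
    by (rule measurable_cong_sets[OF P_sets[OF \<theta>\<^sub>0] refl])
  have [measurable]: "quotient_process T \<in> borel_measurable (P \<theta>\<^sub>0)" for T
    unfolding cong by (intro quotient_process_measurable X_measurable)
  have [measurable]: "?L T \<in> borel_measurable (P \<theta>\<^sub>0)" for T
    unfolding cong by (rule lik_ratio_measurable)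
  have U: "U \<in> Q.events" and G: "G \<in> Q.events"
    unfolding U_def G_def by measurable
  have "?c * emeasure (P \<theta>\<^sub>0) U \<le> (\<integral>\<^sup>+\<omega>. quotient_process 0 \<omega> \<partial>P \<theta>\<^sub>0)"
    unfolding U_def
    by (rule ville_inequality[where F = "past_algebra M \<Omega> X"])
      (auto intro: subalgebra_past_algebra \<theta>\<^sub>0 sets_past_algebra_mono[THEN subsetD]
        quotient_process_measurable past_measurable quotient_process_supermartingale)
  also have "\<dots> = 1"
    by (simp add: quotient_process_def Q.emeasure_space_1)
  finally have "ennreal (1 / \<alpha> * Q.prob U) \<le> ennreal 1"
    using \<alpha> by (subst ennreal_mult) (auto simp: Q.emeasure_eq_measure)
  then have "Q.prob U \<le> \<alpha>"
    using \<alpha> by (subst (asm) ennreal_le_iff) (auto simp: field_simps)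
  then have "1 - \<alpha> \<le> Q.prob (space (P \<theta>\<^sub>0) - U)"
    using Q.prob_compl[OF U] by simp
  also have "\<dots> \<le> Q.prob G"
  \<comment> \<open>The inclusion of the complement of \<open>U\<close> in \<open>G\<close> is
    needed only almost everywhere: a path with a vanishing denominator has an infinite ratio from
    then on, and such paths form a countable union of null sets, one for each time after
    \<open>p\<close>.\<close>
  proof (rule Q.finite_measure_mono_AE[OF _ G])
    have "AE \<omega> in P \<theta>\<^sub>0. \<forall>t. p < t \<longrightarrow> next_denominator t \<omega> (X t \<omega>) \<noteq> 0"
      using AE_next_denominator_nonzero by (subst AE_all_countable) (auto intro: AE_impI)
    then show "AE \<omega> in P \<theta>\<^sub>0. \<omega> \<in> space (P \<theta>\<^sub>0) - U \<longrightarrow> \<omega> \<in> G"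
    proof (rule AE_mp, intro AE_I2 impI)
      fix \<omega> assume "\<forall>t. p < t \<longrightarrow> next_denominator t \<omega> (X t \<omega>) \<noteq> 0"
        and \<omega>: "\<omega> \<in> space (P \<theta>\<^sub>0)" and "\<omega> \<in> space (P \<theta>\<^sub>0) - U"
      then show "\<omega> \<in> G"
        using lik_ratio_eq_quotient_process[of \<omega>]
        by (auto simp: U_def G_def space_P[OF \<theta>\<^sub>0] not_le intro: less_imp_le)
    qed
  qed
  finally show ?thesis
    by (simp add: G_def confidence_set_def \<theta>\<^sub>0)
qed

end

theorem proposition4:
  fixes M :: "'x measure" and N :: "'t measure" and \<Omega> :: "'w measure"
    and p :: nat
    and f0 :: "(nat \<Rightarrow> 'x) \<Rightarrow> 't \<Rightarrow> real"
    and f :: "'x \<Rightarrow> (nat \<Rightarrow> 'x) \<Rightarrow> 't \<Rightarrow> real"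
    and P :: "'t \<Rightarrow> 'w measure"
    and X :: "nat \<Rightarrow> 'w \<Rightarrow> 'x"
    and \<Theta> :: "nat \<Rightarrow> (nat \<Rightarrow> 'x) \<Rightarrow> 't"
    and \<alpha> :: real and \<theta>\<^sub>0 :: 't
  assumes "ar_time_series M N p f0 f \<Omega> P X"
    and "nonanticipatory_estimators M N p \<Theta>"
    and "0 < \<alpha>" and "\<alpha> < 1"
    and "\<theta>\<^sub>0 \<in> space N"
  shows "measure (P \<theta>\<^sub>0)
      {\<omega> \<in> space (P \<theta>\<^sub>0). \<forall>T. \<theta>\<^sub>0 \<in> confidence_set N p f \<Theta> \<alpha> (\<lambda>t. X t \<omega>) T} \<ge> 1 - \<alpha>"
  using assms
  by (intro ar_sequential_estimation.measure_confidence_set)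
    (simp_all add: ar_sequential_estimation_def ar_sequential_estimation_axioms_def)

end
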